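(* Let $\kappa>0$, $a>0$, and let $u=u(\cdot;u_0)$, $u_0>0$, be a solution of $$\frac{u''(r)}{(1-u'(r)^2)^{3/2}}=\kappa\,u(r),\quad -a<r<a,\qquad u'(\pm a)=\pm\tanh\beta ,$$ with $|u'|<1$, $u(0)=u_0$ and $u'(0)=0$. Then $$\frac{\sinh\beta}{a\kappa}+\frac{a}{\sinh\beta}-\frac{a\coth\beta}{2}-\frac{a\beta}{2\sinh^2\beta}<u_0<\frac{\sinh\beta}{a\kappa}.$$
   Context: $u(\cdot;u_0)$ denotes the unique solution on $\mathbb{R}$ of $\dfrac{u''}{(1-u'^2)^{3/2}}=\kappa u$ with $u(0)=u_0$, $u'(0)=0$. The real number $\beta$ is determined by $u'(a)=\tanh\beta$, and $\beta>0$ since $u_0>0$. *)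

theory Defs
  imports Complex_Main
begin

definition coth :: "real \<Rightarrow> real" where
  "coth x = cosh x / sinh x"

end

theory Submission
  imports Defs
begin

text \<open>
  The profile is best described by \<open>s = u' / sqrt (1 - u'\<^sup>2)\<close>, the hyperbolic sine of its inclination
  (rapidity) angle.  The equation then becomes the first order system
  \<open>s' = \<kappa> u\<close>, \<open>u' = s / sqrt (1 + s\<^sup>2)\<close>, with \<open>s 0 = 0\<close> and \<open>s a = sinh \<beta>\<close>.

  The energy \<open>sqrt (1 + s\<^sup>2) - \<kappa> u\<^sup>2 / 2\<close> is conserved, which forces \<open>u \<ge> u 0 > 0\<close>
  (\<open>height_ge_initial\<close>).  Hence \<open>s\<close> and \<open>u\<close> increase strictly, and both bounds arise by replacing
  \<open>u\<close> in \<open>sinh \<beta> = \<kappa> \<integral>\<^sub>0\<^sup>a u\<close> by a comparison profile with the same value at \<open>0\<close>.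

  \<^item> From below, \<open>u\<close> is compared with the constant \<open>u 0\<close>; this gives \<open>\<kappa> a u 0 < sinh \<beta>\<close>
    (\<open>end_inclination_gt\<close>).

  \<^item> From above, \<open>s\<close> is strictly convex, because \<open>s' = \<kappa> u\<close> increases, so it lies under the chord
    \<open>r \<mapsto> r / R\<close> with \<open>R = a / sinh \<beta>\<close>.  That chord is the function \<open>s\<close> of the hyperbola
    \<open>r \<mapsto> u 0 - R + sqrt (R\<^sup>2 + r\<^sup>2)\<close>, which therefore lies above \<open>u\<close>
    (\<open>height_less_hyperbola\<close>).  The integral of the hyperbola is explicit and yields the lower
    bound for \<open>u 0\<close> (\<open>end_inclination_less\<close>).

  One point needs care: the boundary value \<open>tanh \<beta>\<close> is the one-sided derivative of \<open>u\<close> at \<open>a\<close>,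
  whereas the comparison uses it as the limit of \<open>u'\<close>.  The two agree because \<open>u'\<close> is monotone on
  \<open>[0, a)\<close> (\<open>derivative_mono_tendsto_left\<close>).
\<close>

section \<open>Left continuity of a monotone derivative\<close>

text \<open>
  The difference quotients at \<open>b\<close> are values of \<open>f'\<close> at intermediate points.  Monotonicity turns
  their convergence to \<open>f' b\<close> into convergence of \<open>f'\<close> itself.
\<close>

lemma derivative_mono_tendsto_left:
  fixes f f' :: "real \<Rightarrow> real"
  assumes "c < b"
    and deriv: "\<And>x. x \<in> {c..b} \<Longrightarrow> (f has_real_derivative f' x) (at x within {c..b})"
    and mono: "\<And>x y. c \<le> x \<Longrightarrow> x \<le> y \<Longrightarrow> y < b \<Longrightarrow> f' x \<le> f' y"
  shows "(f' \<longlongrightarrow> f' b) (at_left b)"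
proof -
  define q where "q x = (f x - f b) / (x - b)" for x
  have "(f has_real_derivative f' b) (at b within {c..b})"
    using deriv assms(1) by auto
  then have q_lim: "(q \<longlongrightarrow> f' b) (at_left b)"
    using assms(1) unfolding has_field_derivative_iff q_def
    by (simp add: at_within_Icc_at_left)
  have in_interval: "eventually (\<lambda>x. x \<in> {c<..<b}) (at_left b)"
    by (rule eventually_at_left_real[OF assms(1)])
  have q_value: "\<exists>z. x < z \<and> z < b \<and> q x = f' z" if "x \<in> {c<..<b}" for x
  proof -
    have cont: "continuous_on {x..b} f"
      using that by (intro continuous_on_subset[OF DERIV_continuous_on[OF deriv]]) auto
    have deriv_at: "(f has_real_derivative f' y) (at y)" if "x < y" "y < b" for y
      using deriv[of y] that \<open>x \<in> {c<..<b}\<close> by (simp add: at_within_Icc_at)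
    then have "f differentiable (at y)" if "x < y" "y < b" for y
      using that unfolding real_differentiable_def by blast
    moreover have "x < b" using that by simp
    ultimately obtain l z where z: "x < z" "z < b" "(f has_real_derivative l) (at z)"
        "f b - f x = (b - x) * l"
      using MVT[OF _ cont] by blast
    have "l = f' z"
      by (rule DERIV_unique[OF z(3) deriv_at[OF z(1,2)]])
    then have "q x = f' z"
      using z that by (simp add: q_def field_simps)
    then show ?thesis using z by blast
  qed
  have upper: "f' x \<le> q x" if x: "x \<in> {c<..<b}" for x
  proof -
    obtain z where "x < z" "z < b" "q x = f' z" using q_value[OF x] by blast
    then show ?thesis using mono[of x z] x by simp
  qed
  show ?thesis
  proof (rule order_tendstoI)
    fix y assume "y < f' b"
    then have "eventually (\<lambda>x. y < q x \<and> x \<in> {c<..<b}) (at_left b)"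
      using order_tendstoD(1)[OF q_lim] in_interval by (simp add: eventually_conj)
    then obtain x where x: "y < q x" "x \<in> {c<..<b}"
      using eventually_happens'[OF trivial_limit_at_left_real] by blast
    obtain z where z: "x < z" "z < b" "q x = f' z" using q_value[OF x(2)] by blast
    have "eventually (\<lambda>w. w \<in> {z<..<b}) (at_left b)"
      by (rule eventually_at_left_real[OF z(2)])
    then show "eventually (\<lambda>w. y < f' w) (at_left b)"
    proof eventually_elim
      case (elim w)
      then show ?case using mono[of z w] z x by auto
    qed
  next
    fix y assume "f' b < y"
    then have "eventually (\<lambda>x. q x < y) (at_left b)"
      by (rule order_tendstoD(2)[OF q_lim])
    with in_interval show "eventually (\<lambda>x. f' x < y) (at_left b)"
      by eventually_elim (use upper in fastforce)
  qed
qed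

section \<open>The first order system for height and hyperbolic inclination\<close>

locale capillary_system =
  fixes \<kappa> b :: real and u s :: "real \<Rightarrow> real"
  assumes kappa_pos: "\<kappa> > 0" and b_pos: "b > 0"
    and u_initial_pos: "u 0 > 0" and s_initial: "s 0 = 0"
    and u_cont: "continuous_on {0..b} u" and s_cont: "continuous_on {0..b} s"
    and u_deriv: "\<And>r. 0 < r \<Longrightarrow> r < b \<Longrightarrow> (u has_real_derivative s r / sqrt (1 + (s r)\<^sup>2)) (at r)"
    and s_deriv: "\<And>r. 0 < r \<Longrightarrow> r < b \<Longrightarrow> (s has_real_derivative \<kappa> * u r) (at r)"
begin

lemma energy_conserved:
  assumes "r \<in> {0..b}"
  shows "sqrt (1 + (s r)\<^sup>2) - \<kappa> * (u r)\<^sup>2 / 2 = 1 - \<kappa> * (u 0)\<^sup>2 / 2"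
proof -
  define E where "E x = sqrt (1 + (s x)\<^sup>2) - \<kappa> * (u x)\<^sup>2 / 2" for x
  have "E r = E 0"
  proof (rule DERIV_isconst2[of 0 b])
    show "continuous_on {0..b} E"
      unfolding E_def by (intro continuous_intros u_cont s_cont) simp
    fix x :: real assume x: "0 < x" "x < b"
    have "1 + (s x)\<^sup>2 > 0" by (simp add: add_pos_nonneg)
    then show "(E has_real_derivative 0) (at x)"
      unfolding E_def
      by (auto intro!: derivative_eq_intros u_deriv s_deriv x simp: field_simps)
  qed (use assms b_pos in auto)
  then show ?thesis by (simp add: E_def s_initial)
qed

text \<open>
  Energy conservation gives \<open>(u r)\<^sup>2 \<ge> (u 0)\<^sup>2\<close>, so \<open>u\<close> never vanishes and by continuity cannot jump
  to the negative branch.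
\<close>

lemma height_ge_initial:
  assumes r: "r \<in> {0..b}"
  shows "u 0 \<le> u r"
proof -
  have sq: "(u 0)\<^sup>2 \<le> (u x)\<^sup>2" if "x \<in> {0..b}" for x
  proof -
    have "\<kappa> * (u 0)\<^sup>2 \<le> \<kappa> * (u x)\<^sup>2"
    proof -
      have "1 \<le> sqrt (1 + (s x)\<^sup>2)" by simp
      then show ?thesis using energy_conserved[OF that] by linarith
    qed
    then show ?thesis using kappa_pos by simp
  qed
  have "u r > 0"
  proof (rule ccontr)
    assume "\<not> u r > 0"
    then obtain x where "0 \<le> x" "x \<le> r" "u x = 0"
      using IVT2'[of u r 0 0] r u_initial_pos continuous_on_subset[OF u_cont, of "{0..r}"]
      by auto
    then show False using sq[of x] r u_initial_pos by auto
  qed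
  then show ?thesis using sq[OF r] by (simp add: power2_le_iff_abs_le u_initial_pos)
qed

lemma inclination_strict_mono:
  assumes "0 \<le> x" "x < y" "y \<le> b"
  shows "s x < s y"
proof (rule DERIV_pos_imp_increasing_open[OF assms(2)])
  fix r assume r: "x < r" "r < y"
  then have "u r > 0" using height_ge_initial[of r] u_initial_pos assms by auto
  then show "\<exists>d. (s has_real_derivative d) (at r) \<and> d > 0"
    using s_deriv[of r] kappa_pos r assms by (intro exI[of _ "\<kappa> * u r"]) auto
qed (use assms continuous_on_subset[OF s_cont] in auto)

lemma height_strict_mono:
  assumes "0 \<le> x" "x < y" "y \<le> b"
  shows "u x < u y"
proof (rule DERIV_pos_imp_increasing_open[OF assms(2)])
  fix r assume r: "x < r" "r < y"
  then have "s r > 0" using inclination_strict_mono[of 0 r] s_initial assms by auto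
  then show "\<exists>d. (u has_real_derivative d) (at r) \<and> d > 0"
    using u_deriv[of r] r assms
    by (intro exI[of _ "s r / sqrt (1 + (s r)\<^sup>2)"]) (auto simp: add_pos_nonneg)
qed (use assms continuous_on_subset[OF u_cont] in auto)

lemma end_inclination_gt: "\<kappa> * b * u 0 < s b"
proof -
  have "s 0 - \<kappa> * 0 * u 0 < s b - \<kappa> * b * u 0"
  proof (rule DERIV_pos_imp_increasing_open[OF b_pos])
    fix r assume r: "0 < r" "r < b"
    have "((\<lambda>r. s r - \<kappa> * r * u 0) has_real_derivative \<kappa> * (u r - u 0)) (at r)"
      by (auto intro!: derivative_eq_intros s_deriv r simp: algebra_simps)
    then show "\<exists>d. ((\<lambda>r. s r - \<kappa> * r * u 0) has_real_derivative d) (at r) \<and> d > 0"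
      using height_strict_mono[of 0 r] r kappa_pos
      by (intro exI[of _ "\<kappa> * (u r - u 0)"]) simp
  qed (intro continuous_intros s_cont)
  then show ?thesis by (simp add: s_initial)
qed

text \<open>
  The average slopes of \<open>s\<close> on \<open>[0, r]\<close> and \<open>[r, b]\<close> are values of the strictly increasing
  function \<open>\<kappa> u\<close>, so the second is larger.
\<close>

lemma inclination_less_chord:
  assumes r: "0 < r" "r < b"
  shows "s r < r * (s b / b)"
proof -
  have mvt: "\<exists>z. x < z \<and> z < y \<and> s y - s x = (y - x) * (\<kappa> * u z)"
    if xy: "0 \<le> x" "x < y" "y \<le> b" for x y
  proof -
    have "continuous_on {x..y} s"
      using continuous_on_subset[OF s_cont] xy by auto
    moreover have "s differentiable (at w)" if "x < w" "w < y" for w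
      using s_deriv[of w] that xy by (auto simp: real_differentiable_def)
    ultimately obtain l z where z: "x < z" "z < y" "(s has_real_derivative l) (at z)"
        "s y - s x = (y - x) * l"
      using MVT[OF xy(2), of s] by blast
    moreover have "l = \<kappa> * u z"
      using DERIV_unique[OF z(3) s_deriv[of z]] z xy by auto
    ultimately show ?thesis by blast
  qed
  obtain y where y: "0 < y" "y < r" "s r = r * (\<kappa> * u y)"
    using mvt[of 0 r] r s_initial by auto
  obtain z where z: "r < z" "z < b" "s b - s r = (b - r) * (\<kappa> * u z)"
    using mvt[of r b] r by auto
  have "\<kappa> * u y < \<kappa> * u z"
    using height_strict_mono[of y z] y z r kappa_pos by simp
  then have "r * ((b - r) * (\<kappa> * u y)) < r * ((b - r) * (\<kappa> * u z))"
    using r by simp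
  moreover have "r * ((b - r) * (\<kappa> * u y)) = (b - r) * s r"
    by (simp add: y(3))
  ultimately have "(b - r) * s r < r * (s b - s r)"
    by (simp add: z(3))
  then have "s r * b < r * s b"
    by (simp add: algebra_simps)
  then show ?thesis using b_pos by (simp add: field_simps)
qed

text \<open>
  Both profiles start at height \<open>u 0\<close>.  The hyperbola has hyperbolic inclination \<open>x / R\<close>, which
  exceeds \<open>s x\<close> by the chord estimate, and \<open>t \<mapsto> t / sqrt (1 + t\<^sup>2)\<close> is increasing, so the hyperbola
  is steeper at every interior point.
\<close>

lemma height_less_hyperbola:
  assumes R: "R = b / s b" and r: "0 < r" "r < b"
  shows "u r < u 0 - R + sqrt (R\<^sup>2 + r\<^sup>2)"
proof -
  have sb: "s b > 0" using inclination_strict_mono[of 0 b] b_pos s_initial by simp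
  have Rpos: "R > 0" using R sb b_pos by simp
  have sqrt_pos: "R\<^sup>2 + x\<^sup>2 > 0" for x using Rpos by (simp add: add_pos_nonneg)
  have chord: "s b / b = 1 / R" using R by simp
  define h where "h x = sqrt (R\<^sup>2 + x\<^sup>2) - u x" for x
  have "h 0 < h r"
  proof (rule DERIV_pos_imp_increasing_open[OF r(1)])
    fix x assume x: "0 < x" "x < r"
    have s: "0 < s x" "s x * R < x"
      using inclination_strict_mono[of 0 x] inclination_less_chord[of x] x r s_initial Rpos chord
      by (auto simp: field_simps)
    have "(s x * R)\<^sup>2 < x\<^sup>2"
      using s Rpos by (intro power_strict_mono) auto
    then have "(s x)\<^sup>2 * (R\<^sup>2 + x\<^sup>2) < x\<^sup>2 * (1 + (s x)\<^sup>2)"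
      by (simp add: algebra_simps power_mult_distrib)
    then have "sqrt ((s x)\<^sup>2 * (R\<^sup>2 + x\<^sup>2)) < sqrt (x\<^sup>2 * (1 + (s x)\<^sup>2))"
      by simp
    then have "s x * sqrt (R\<^sup>2 + x\<^sup>2) < x * sqrt (1 + (s x)\<^sup>2)"
      using s x by (simp add: real_sqrt_mult)
    then have "s x / sqrt (1 + (s x)\<^sup>2) < x / sqrt (R\<^sup>2 + x\<^sup>2)"
      using sqrt_pos[of x] by (simp add: divide_simps add_pos_nonneg mult.commute)
    moreover have "(h has_real_derivative x / sqrt (R\<^sup>2 + x\<^sup>2) - s x / sqrt (1 + (s x)\<^sup>2)) (at x)"
      unfolding h_def using x r sqrt_pos[of x]
      by (auto intro!: derivative_eq_intros u_deriv simp: field_simps)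
    ultimately show "\<exists>d. (h has_real_derivative d) (at x) \<and> d > 0"
      by (intro exI[of _ "x / sqrt (R\<^sup>2 + x\<^sup>2) - s x / sqrt (1 + (s x)\<^sup>2)"]) simp
  next
    show "continuous_on {0..r} h"
      unfolding h_def using r
      by (intro continuous_intros continuous_on_subset[OF u_cont]) auto
  qed
  then show ?thesis using Rpos by (simp add: h_def)
qed

text \<open>
  The right-hand side is \<open>\<kappa>\<close> times the integral of the hyperbola over \<open>[0, b]\<close>, whereas
  \<open>s b = \<kappa> \<integral>\<^sub>0\<^sup>b u\<close>.  Comparing derivatives of primitives takes the place of comparing integrals.
\<close>

lemma end_inclination_less:
  assumes R: "R = b / s b"
  shows "s b < \<kappa> * ((u 0 - R) * b + (b * sqrt (R\<^sup>2 + b\<^sup>2) + R\<^sup>2 * arsinh (s b)) / 2)"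
proof -
  have sb: "s b > 0" using inclination_strict_mono[of 0 b] b_pos s_initial by simp
  have Rpos: "R > 0" using R sb b_pos by simp
  have sqrt_pos: "R\<^sup>2 + x\<^sup>2 > 0" for x using Rpos by (simp add: add_pos_nonneg)
  define P where "P x = (x * sqrt (R\<^sup>2 + x\<^sup>2) + R\<^sup>2 * arsinh (x / R)) / 2" for x
  have P_deriv: "(P has_real_derivative sqrt (R\<^sup>2 + x\<^sup>2)) (at x)" for x
  proof -
    have "sqrt ((x / R)\<^sup>2 + 1) = sqrt ((R\<^sup>2 + x\<^sup>2) / R\<^sup>2)"
      using Rpos by (simp add: field_simps)
    then have root: "sqrt ((x / R)\<^sup>2 + 1) = sqrt (R\<^sup>2 + x\<^sup>2) / R"
      using Rpos by (simp add: real_sqrt_divide)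
    have arsinh_deriv: "((\<lambda>x. arsinh (x / R)) has_real_derivative 1 / sqrt ((x / R)\<^sup>2 + 1) * (1 / R)) (at x)"
      by (rule DERIV_chain2[OF arsinh_real_has_field_derivative])
        (use Rpos in \<open>auto intro!: derivative_eq_intros\<close>)
    have "(P has_real_derivative
        (sqrt (R\<^sup>2 + x\<^sup>2) + x * (x / sqrt (R\<^sup>2 + x\<^sup>2)) + R\<^sup>2 * (1 / sqrt ((x / R)\<^sup>2 + 1) * (1 / R))) / 2) (at x)"
      unfolding P_def using sqrt_pos[of x] Rpos
      by (auto intro!: derivative_eq_intros arsinh_deriv simp: divide_simps)
    also have "(sqrt (R\<^sup>2 + x\<^sup>2) + x * (x / sqrt (R\<^sup>2 + x\<^sup>2)) + R\<^sup>2 * (1 / sqrt ((x / R)\<^sup>2 + 1) * (1 / R))) / 2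
        = (sqrt (R\<^sup>2 + x\<^sup>2) + (R\<^sup>2 + x\<^sup>2) / sqrt (R\<^sup>2 + x\<^sup>2)) / 2"
      unfolding root using Rpos sqrt_pos[of x] by (simp add: field_simps power2_eq_square)
    also have "\<dots> = sqrt (R\<^sup>2 + x\<^sup>2)"
      using sqrt_pos[of x] by (simp add: real_div_sqrt)
    finally show ?thesis .
  qed
  define G where "G x = \<kappa> * ((u 0 - R) * x + P x) - s x" for x
  have "G 0 < G b"
  proof (rule DERIV_pos_imp_increasing_open[OF b_pos])
    fix x assume x: "0 < x" "x < b"
    have "(G has_real_derivative \<kappa> * (u 0 - R + sqrt (R\<^sup>2 + x\<^sup>2) - u x)) (at x)"
      unfolding G_def
      by (auto intro!: derivative_eq_intros P_deriv s_deriv x simp: algebra_simps)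
    then show "\<exists>d. (G has_real_derivative d) (at x) \<and> d > 0"
      using height_less_hyperbola[OF R x] kappa_pos
      by (intro exI[of _ "\<kappa> * (u 0 - R + sqrt (R\<^sup>2 + x\<^sup>2) - u x)"]) simp
  next
    have "continuous_on {0..b} P"
      by (rule DERIV_continuous_on[OF has_field_derivative_at_within[OF P_deriv]])
    then show "continuous_on {0..b} G"
      unfolding G_def by (intro continuous_intros s_cont)
  qed
  moreover have "b / R = s b" using R b_pos sb by simp
  ultimately show ?thesis by (simp add: G_def P_def s_initial)
qed

end

section \<open>From the second order equation to the system\<close>

text \<open>
  If \<open>v = tanh \<psi>\<close> then \<open>v / sqrt (1 - v\<^sup>2) = sinh \<psi>\<close>; the derivative \<open>(1 - v\<^sup>2) powr (- 3 / 2)\<close> is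
  exactly the factor in the curvature operator.
\<close>

lemma sinh_inclination_deriv:
  fixes v :: "real \<Rightarrow> real"
  assumes "(v has_real_derivative d) (at r)" "\<bar>v r\<bar> < 1"
  shows "((\<lambda>r. v r / sqrt (1 - (v r)\<^sup>2)) has_real_derivative d / (1 - (v r)\<^sup>2) powr (3/2)) (at r)"
proof -
  have pos: "1 - (v r)\<^sup>2 > 0" using assms(2) by (simp add: abs_square_less_1)
  define w where "w = sqrt (1 - (v r)\<^sup>2)"
  have w: "w > 0" "w\<^sup>2 = 1 - (v r)\<^sup>2" using pos by (auto simp: w_def)
  have "(1 - (v r)\<^sup>2) powr (3/2) = (1 - (v r)\<^sup>2) powr (1 + 1/2)" by simp
  also have "\<dots> = w\<^sup>2 * w"
    unfolding powr_add using pos by (simp add: powr_half_sqrt w_def)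
  finally have "(1 - (v r)\<^sup>2) powr (3/2) = w ^ 3" by (simp add: power2_eq_square power3_eq_cube)
  moreover have "((\<lambda>r. v r / sqrt (1 - (v r)\<^sup>2)) has_real_derivative
      (d * w + v r * (v r * d / w)) / w\<^sup>2) (at r)"
    unfolding w_def using pos
    by (auto intro!: derivative_eq_intros assms(1) simp: field_simps)
  moreover have "(d * w + v r * (v r * d / w)) / w\<^sup>2 = d * (w\<^sup>2 + (v r)\<^sup>2) / w ^ 3"
    using w(1) by (simp add: field_simps power2_eq_square power3_eq_cube)
  ultimately show ?thesis using w(2) by simp
qed

text \<open>This inversion turns the definition of \<open>s\<close> into the first equation \<open>u' = s / sqrt (1 + s\<^sup>2)\<close>.\<close>

lemma sinh_inclination_inverse:
  fixes v :: real
  assumes "\<bar>v\<bar> < 1"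
  defines "s \<equiv> v / sqrt (1 - v\<^sup>2)"
  shows "s / sqrt (1 + s\<^sup>2) = v"
proof -
  have pos: "1 - v\<^sup>2 > 0" using assms(1) by (simp add: abs_square_less_1)
  have "1 + s\<^sup>2 = 1 / (1 - v\<^sup>2)"
    unfolding s_def using pos by (simp add: power_divide field_simps)
  then have "sqrt (1 + s\<^sup>2) = 1 / sqrt (1 - v\<^sup>2)" by (simp add: real_sqrt_divide)
  then show ?thesis unfolding s_def using pos by simp
qed

lemma sinh_inclination_tanh:
  fixes x :: real
  shows "tanh x / sqrt (1 - (tanh x)\<^sup>2) = sinh x"
proof -
  have "1 - (tanh x)\<^sup>2 = 1 / (cosh x)\<^sup>2"
    using cosh_real_pos[of x] hyperbolic_pythagoras[of x]
    by (simp add: tanh_def power_divide diff_divide_eq_iff del: cosh_square_eq)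
  then have "sqrt (1 - (tanh x)\<^sup>2) = 1 / cosh x"
    by (simp add: real_sqrt_divide)
  then show ?thesis by (simp add: tanh_def)
qed

theorem theorem5p3:
  fixes \<kappa> a \<beta> u0 :: real and u u' u'' :: "real \<Rightarrow> real"
  assumes "\<kappa> > 0" and "a > 0" and "u0 > 0"
    and deriv_u: "\<And>r. r \<in> {-a..a} \<Longrightarrow> (u has_real_derivative u' r) (at r within {-a..a})"
    and deriv_u': "\<And>r. r \<in> {-a<..<a} \<Longrightarrow> (u' has_real_derivative u'' r) (at r)"
    and spacelike: "\<And>r. r \<in> {-a<..<a} \<Longrightarrow> \<bar>u' r\<bar> < 1"
    and ode: "\<And>r. r \<in> {-a<..<a} \<Longrightarrow> u'' r / (1 - (u' r)\<^sup>2) powr (3/2) = \<kappa> * u r"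
    and boundary: "u' a = tanh \<beta>" "u' (-a) = - tanh \<beta>"
    and initial: "u 0 = u0" "u' 0 = 0"
  shows "sinh \<beta> / (a * \<kappa>) + a / sinh \<beta> - a * coth \<beta> / 2 - a * \<beta> / (2 * (sinh \<beta>)\<^sup>2) < u0 \<and>
         u0 < sinh \<beta> / (a * \<kappa>)"
proof -
  define s where "s = (\<lambda>r. u' r / sqrt (1 - (u' r)\<^sup>2))"
  have s_deriv: "(s has_real_derivative \<kappa> * u r) (at r)" if "r \<in> {-a<..<a}" for r
    using sinh_inclination_deriv[OF deriv_u'[OF that] spacelike[OF that]] ode[OF that]
    by (simp add: s_def)
  have u_deriv: "(u has_real_derivative s r / sqrt (1 + (s r)\<^sup>2)) (at r)" if "r \<in> {-a<..<a}" for r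
    using sinh_inclination_inverse[OF spacelike[OF that]] deriv_u[of r] that
    by (simp add: at_within_Icc_at s_def)
  have u_cont: "continuous_on {0..a} u"
    using \<open>a > 0\<close> by (intro continuous_on_subset[OF DERIV_continuous_on[OF deriv_u]]) auto

  \<comment> \<open>Continuity of \<open>u'\<close> at \<open>a\<close> rests on its monotonicity, hence on the sign of \<open>u\<close>, so the system is
    considered on \<open>[0, b]\<close> with \<open>b < a\<close> before it is considered on \<open>[0, a]\<close>.\<close>
  have u_pos: "u b > 0" if b: "0 < b" "b < a" for b
  proof -
    have "continuous_on {0..b} s"
      using b by (intro DERIV_continuous_on[OF has_field_derivative_at_within[OF s_deriv]]) auto
    then interpret inner: capillary_system \<kappa> b u s
      using b assms(1,3) initial u_deriv s_deriv continuous_on_subset[OF u_cont, of "{0..b}"]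
      by unfold_locales (auto simp: s_def)
    show ?thesis using inner.height_ge_initial[of b] inner.u_initial_pos b by simp
  qed
  have u''_nonneg: "u'' r \<ge> 0" if r: "0 \<le> r" "r < a" for r
  proof -
    have "u r > 0" using u_pos[of r] r initial \<open>u0 > 0\<close> by (cases "r = 0") auto
    then have "u'' r / (1 - (u' r)\<^sup>2) powr (3/2) > 0" using ode[of r] r \<open>\<kappa> > 0\<close> by simp
    then show ?thesis by (simp add: zero_less_divide_iff)
  qed
  have u'_mono: "u' x \<le> u' y" if "0 \<le> x" "x \<le> y" "y < a" for x y
    by (rule DERIV_nonneg_imp_nondecreasing[OF that(2)])
      (use that u''_nonneg deriv_u' in \<open>force intro!: exI[of _ "u'' _"]\<close>)
  have "(u' \<longlongrightarrow> u' a) (at_left a)"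
    by (rule derivative_mono_tendsto_left[OF \<open>a > 0\<close> _ u'_mono])
      (use \<open>a > 0\<close> in \<open>auto intro!: has_field_derivative_subset[OF deriv_u]\<close>)
  moreover have "1 - (u' a)\<^sup>2 \<noteq> 0"
    using tanh_real_bounds[of \<beta>] by (simp add: boundary(1) power2_eq_1_iff)
  ultimately have "(s \<longlongrightarrow> s a) (at_left a)"
    unfolding s_def by (intro tendsto_intros) auto
  then have "(s \<longlongrightarrow> s x) (at x within {0..a})" if "x \<in> {0..a}" for x
    using that \<open>a > 0\<close> s_deriv[of x]
    by (cases "x = a")
      (auto simp: at_within_Icc_at_left continuous_at dest!: DERIV_isCont intro: tendsto_within_subset[of _ _ _ UNIV])
  then have "continuous_on {0..a} s" by (simp add: continuous_on_def)
  then interpret capillary_system \<kappa> a u s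
    using assms(1-3) initial u_deriv s_deriv u_cont by unfold_locales (auto simp: s_def)

  \<comment> \<open>The substitution \<open>s a = sinh \<beta>\<close>, under which \<open>sqrt (R\<^sup>2 + a\<^sup>2) = a coth \<beta>\<close>, turns the estimates
    on \<open>s a\<close> into the stated bounds.\<close>
  have sa: "s a = sinh \<beta>" by (simp add: s_def boundary(1) sinh_inclination_tanh)
  have sinh_pos: "sinh \<beta> > 0" using inclination_strict_mono[of 0 a] \<open>a > 0\<close> s_initial sa by simp
  define R where "R = a / sinh \<beta>"
  have "R\<^sup>2 + a\<^sup>2 = (a * cosh \<beta> / sinh \<beta>)\<^sup>2"
    using sinh_pos by (simp add: R_def power_divide power_mult_distrib cosh_square_eq field_simps)
  then have hyp: "sqrt (R\<^sup>2 + a\<^sup>2) = a * coth \<beta>"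
    using sinh_pos \<open>a > 0\<close> by (simp add: coth_def)
  have "sinh \<beta> < \<kappa> * ((u0 - R) * a + (a * (a * coth \<beta>) + R\<^sup>2 * \<beta>) / 2)"
    using end_inclination_less[of R] by (simp add: sa R_def[symmetric] hyp initial arsinh_sinh_real)
  then have "sinh \<beta> / (a * \<kappa>) < ((u0 - R) * a + (a * (a * coth \<beta>) + R\<^sup>2 * \<beta>) / 2) / a"
    using \<open>\<kappa> > 0\<close> \<open>a > 0\<close> by (simp add: field_simps)
  also have "\<dots> = u0 - R + a * coth \<beta> / 2 + R\<^sup>2 * \<beta> / (2 * a)"
    using \<open>a > 0\<close> by (simp add: field_simps)
  also have "R\<^sup>2 * \<beta> / (2 * a) = a * \<beta> / (2 * (sinh \<beta>)\<^sup>2)"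
    using \<open>a > 0\<close> by (simp add: R_def power_divide power2_eq_square)
  finally have lower: "sinh \<beta> / (a * \<kappa>) + a / sinh \<beta> - a * coth \<beta> / 2 - a * \<beta> / (2 * (sinh \<beta>)\<^sup>2) < u0"
    by (simp add: R_def)
  have "u0 < sinh \<beta> / (a * \<kappa>)"
    using end_inclination_gt \<open>\<kappa> > 0\<close> \<open>a > 0\<close> by (simp add: sa initial field_simps)
  with lower show ?thesis by blast
qed

end
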